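(* Let $d=1$, $\mu>-\frac12$, $\mu\ne0$. For $0\le k\le n$, the norm of $\mathsf{V}_{k,n}$ is given by $$b_\mu\int_{\mathbb{V}^2}|\mathsf{V}_{k,n}(x,t)|^2W_\mu(x,t)\,dx\,dt=\sum_{i=0}^{\lfloor k/2\rfloor}[c_{k,i}^\mu]^2\,h_{k-2i}^\mu\,\bigl\|q_{n-k+2i}^{2(k-2i)+2\mu}\bigr\|^2,$$ where $h_m^\mu=\dfrac{\mu(2\mu)_m}{(m+\mu)\,m!}$, and $h_{k-2i}^\mu$ can be rewritten as $$h_{k-2i}^\mu=\frac{(2\mu)_k\,\mu}{k!\,(k-2i+\mu)}\,\frac{(-\frac k2)_i(\frac{-k+1}2)_i}{(\frac{-k+1}{2}-\mu)_i(\frac{-k+2}{2}-\mu)_i},$$ and $$\bigl\|q_{n-j}^{2j+2\mu}\bigr\|^2=b_\mu^w\int_0^\infty\bigl|q_{n-j}^{2j+2\mu}(t)\bigr|^2t^{2j+2\mu}w(t)\,dt .$$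
   Context: $\mathbb{V}^2=\{(x,t)\in\mathbb{R}^2:|x|\le t,\ t\ge0\}$ and $W_\mu(x,t)=w(t)(t^2-x^2)^{\mu-\frac12}$, where $w$ is a weight function on $\mathbb{R}_+=[0,\infty)$ (possibly supported on $[0,1]$): $w\ge0$ and $\int_0^\infty t^{2\mu+j}w(t)\,dt$ is finite and positive for all integers $j\ge0$. $b_\mu^w=\bigl(\int_0^\infty t^{2\mu}w(t)\,dt\bigr)^{-1}$, and $b_\mu=\bigl(\int_{\mathbb{V}^2}W_\mu\,dx\,dt\bigr)^{-1}=b_\mu^w\,\frac{\Gamma(\mu+1)}{\sqrt\pi\,\Gamma(\mu+\frac12)}$. $(a)_k=a(a+1)\cdots(a+k-1)$. For $0\le k\le n$, $q_{n-k}^{2k+2\mu}$ is the monic polynomial of degree $n-k$ orthogonal with respect to $t^{2k+2\mu}w(t)$ on $\mathbb{R}_+$, $C_k^\mu$ is the Gegenbauer polynomial, $\mathsf{S}_{k,n}(x,t)=q_{n-k}^{2k+2\mu}(t)\,t^kC_k^{\mu}(x/t)$, and $$\mathsf{V}_{k,n}=\sum_{j=0}^{\lfloor k/2\rfloor}c_{k,j}^{\mu}\,\mathsf{S}_{k-2j,n},\qquad c_{k,j}^\mu=\frac{k!}{2^k}\,\frac{k-2j+\mu}{(\mu)_{k-j+1}\,j!}.$$ *)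

theory Defs
  imports "HOL-Analysis.Analysis" "HOL-Computational_Algebra.Polynomial"
begin

(* The convention 0 powr a = 0 (even for a = 0) affects only null sets here: the point t = 0
   of the half line and the boundary |x| = t of the cone. *)

definition cone_V2 :: "(real \<times> real) set" where
  "cone_V2 = {(x, t). \<bar>x\<bar> \<le> t \<and> 0 \<le> t}"

definition weight_W :: "(real \<Rightarrow> real) \<Rightarrow> real \<Rightarrow> real \<Rightarrow> real \<Rightarrow> real" where
  "weight_W w \<mu> x t = w t * (t\<^sup>2 - x\<^sup>2) powr (\<mu> - 1/2)"

(* Only the values of w on the half line matter. *)
definition weight_fun :: "(real \<Rightarrow> real) \<Rightarrow> real \<Rightarrow> bool" where
  "weight_fun w \<mu> \<longleftrightarrow>
     (\<forall>t\<ge>0. 0 \<le> w t) \<and>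
     (\<forall>j::nat. set_integrable lborel {0..} (\<lambda>t. t powr (2 * \<mu> + real j) * w t) \<and>
               0 < (LINT t:{0..}|lborel. t powr (2 * \<mu> + real j) * w t))"

definition b_w :: "(real \<Rightarrow> real) \<Rightarrow> real \<Rightarrow> real" where
  "b_w w \<mu> = inverse (LINT t:{0..}|lborel. t powr (2 * \<mu>) * w t)"

definition b_cone :: "(real \<Rightarrow> real) \<Rightarrow> real \<Rightarrow> real" where
  "b_cone w \<mu> = inverse (set_lebesgue_integral lborel cone_V2 (\<lambda>(x, t). weight_W w \<mu> x t))"

definition monic_orthogonal :: "(real \<Rightarrow> real) \<Rightarrow> real \<Rightarrow> nat \<Rightarrow> real poly \<Rightarrow> bool" where
  "monic_orthogonal w \<alpha> m p \<longleftrightarrow>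
     degree p = m \<and> lead_coeff p = 1 \<and>
     (\<forall>r. degree r < m \<longrightarrow>
        (LINT t:{0..}|lborel. poly p t * poly r t * (t powr \<alpha> * w t)) = 0)"

(* orth_q w \<alpha> m is q_m^\<alpha>; it exists and is unique as soon as the weight t^\<alpha> w(t) has
   finite moments and is not almost everywhere zero. *)
definition orth_q :: "(real \<Rightarrow> real) \<Rightarrow> real \<Rightarrow> nat \<Rightarrow> real poly" where
  "orth_q w \<alpha> m = (THE p. monic_orthogonal w \<alpha> m p)"

(* The squared norm of q_m^{2j+2\<mu>}; the normalization is that of t^{2\<mu>} w(t), whatever j is. *)
definition q_normsq :: "(real \<Rightarrow> real) \<Rightarrow> real \<Rightarrow> nat \<Rightarrow> nat \<Rightarrow> real" where
  "q_normsq w \<mu> j m =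
     b_w w \<mu> * (LINT t:{0..}|lborel.
       \<bar>poly (orth_q w (2 * real j + 2 * \<mu>) m) t\<bar>\<^sup>2 * t powr (2 * real j + 2 * \<mu>) * w t)"

(* Standard normalization: the coefficient of r^k in (1 - 2 x r + r^2)^{-\<mu>}. *)
definition gegenbauer :: "real \<Rightarrow> nat \<Rightarrow> real poly" where
  "gegenbauer \<mu> k =
     (\<Sum>j\<le>k div 2. monom ((- 1) ^ j * pochhammer \<mu> (k - j) * 2 ^ (k - 2 * j)
                          / (fact j * fact (k - 2 * j))) (k - 2 * j))"

(* At t = 0 the quotient x / t is 0; the only point of the cone concerned is the origin. *)
definition S_basis :: "(real \<Rightarrow> real) \<Rightarrow> real \<Rightarrow> nat \<Rightarrow> nat \<Rightarrow> real \<Rightarrow> real \<Rightarrow> real" where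
  "S_basis w \<mu> k n x t =
     poly (orth_q w (2 * real k + 2 * \<mu>) (n - k)) t * (t ^ k * poly (gegenbauer \<mu> k) (x / t))"

definition c_coeff :: "real \<Rightarrow> nat \<Rightarrow> nat \<Rightarrow> real" where
  "c_coeff \<mu> k j =
     fact k / 2 ^ k * ((real (k - 2 * j) + \<mu>) / (pochhammer \<mu> (k - j + 1) * fact j))"

definition V_poly :: "(real \<Rightarrow> real) \<Rightarrow> real \<Rightarrow> nat \<Rightarrow> nat \<Rightarrow> real \<Rightarrow> real \<Rightarrow> real" where
  "V_poly w \<mu> k n x t = (\<Sum>j\<le>k div 2. c_coeff \<mu> k j * S_basis w \<mu> (k - 2 * j) n x t)"

definition h_norm :: "real \<Rightarrow> nat \<Rightarrow> real" where
  "h_norm \<mu> m = \<mu> * pochhammer (2 * \<mu>) m / ((real m + \<mu>) * fact m)"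

end

theory Submission
  imports Defs
begin

text \<open>
  Substituting $x = t y$ turns $W_\mu\,dx\,dt$ into $t^{2\mu} w(t)\,dt\,(1 - y^2)^{\mu - 1/2}\,dy$
  and $V_{k,n}$ into a sum of products of a polynomial in $t$ and a Gegenbauer polynomial in $y$, so
  orthogonality of the Gegenbauer polynomials removes the off-diagonal terms of the square; no
  property of the factors $q$ is involved. Integration by parts makes the Gegenbauer differential
  operator symmetric, whence orthogonality, and the three-term recurrence then determines the ratio
  of consecutive norms. Only norms relative to the total mass of $(1 - y^2)^{\mu - 1/2}$ matter,
  because $b_\mu$ divides by it.
\<close>

section \<open>Gegenbauer polynomials: coefficients, recurrence, differential equation\<close>

text \<open>The coefficient of x^m in \<open>gegenbauer \<mu> (m + 2 * j)\<close>. Indexing by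
  \<open>j\<close> and \<open>m\<close> instead of the degree avoids truncated subtraction in the
  coefficient comparisons.\<close>

definition geg_coeff :: "real \<Rightarrow> nat \<Rightarrow> nat \<Rightarrow> real" where
  "geg_coeff \<mu> j m = (- 1) ^ j * pochhammer \<mu> (m + j) * 2 ^ m / (fact j * fact m)"

lemma coeff_gegenbauer_add: "coeff (gegenbauer \<mu> (m + 2 * j)) m = geg_coeff \<mu> j m"
proof -
  have eq: "m = m + 2 * j - 2 * i \<longleftrightarrow> i = j" if "i \<le> (m + 2 * j) div 2" for i
    using that by linarith
  have "coeff (gegenbauer \<mu> (m + 2 * j)) m =
      (\<Sum>i\<le>(m + 2 * j) div 2. if i = j then geg_coeff \<mu> j m else 0)"
    unfolding gegenbauer_def coeff_sum coeff_monom geg_coeff_def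
    by (rule sum.cong) (use eq in \<open>auto simp: algebra_simps\<close>)
  also have "\<dots> = geg_coeff \<mu> j m"
    by (subst sum.delta) auto
  finally show ?thesis .
qed

lemma coeff_gegenbauer_eq_0:
  assumes "\<And>j. n \<noteq> m + 2 * j"
  shows "coeff (gegenbauer \<mu> n) m = 0"
proof -
  have "n - 2 * j \<noteq> m" if "j \<le> n div 2" for j
    using assms[of j] that by linarith
  thus ?thesis
    unfolding gegenbauer_def coeff_sum coeff_monom by (intro sum.neutral) auto
qed

text \<open>Coefficients of x^m are compared. Unless m has the parity of n and m \<le> n + 2,
  everything vanishes; the top degree and the constant term are treated apart because one term on
  the right is missing there.\<close>

lemma gegenbauer_recurrence:
  "smult (real n + 2) (gegenbauer \<mu> (n + 2)) =
     smult (2 * (real n + 1 + \<mu>)) ([:0, 1:] * gegenbauer \<mu> (n + 1))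
     - smult (real n + 2 * \<mu>) (gegenbauer \<mu> n)" (is "?l = ?r")
proof (rule poly_eqI)
  fix m
  show "coeff ?l m = coeff ?r m"
  proof (cases "\<exists>j. n + 2 = m + 2 * j")
    case False
    hence 1: "coeff (gegenbauer \<mu> (n + 2)) m = 0"
      by (intro coeff_gegenbauer_eq_0) auto
    have 2: "coeff (gegenbauer \<mu> n) m = 0"
    proof (rule coeff_gegenbauer_eq_0)
      show "n \<noteq> m + 2 * j" for j
        using False by (metis add.assoc mult_Suc_right add.commute)
    qed
    have 3: "coeff ([:0, 1:] * gegenbauer \<mu> (n + 1)) m = 0"
    proof (cases m)
      case (Suc l)
      have "n + 1 \<noteq> l + 2 * j" for j
        using False Suc by auto
      thus ?thesis using Suc by (simp add: coeff_pCons coeff_gegenbauer_eq_0)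
    qed simp
    show ?thesis unfolding coeff_diff coeff_smult 1 2 3 by simp
  next
    case True
    then obtain j where j: "n + 2 = m + 2 * j" by blast
    show ?thesis
    proof (cases j)
      \<comment> \<open>Top degree m = n + 2, beyond the degree of
        \<open>gegenbauer \<mu> n\<close>.\<close>
      case 0
      have 2: "coeff (gegenbauer \<mu> n) m = 0"
        using j 0 by (intro coeff_gegenbauer_eq_0) auto
      from j 0 have m: "m = Suc (n + 1)" by simp
      have 1: "coeff (gegenbauer \<mu> (n + 2)) m = geg_coeff \<mu> 0 m"
        using coeff_gegenbauer_add[of \<mu> m 0] m by simp
      have 3: "coeff (gegenbauer \<mu> (n + 1)) (n + 1) = geg_coeff \<mu> 0 (n + 1)"
        using coeff_gegenbauer_add[of \<mu> "n+1" 0] by simp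
      have P: "pochhammer \<mu> (n + 2) = pochhammer \<mu> (n + 1) * (real n + 1 + \<mu>)"
        using pochhammer_Suc[of \<mu> "n + 1"] by (simp add: algebra_simps)
      have F: "fact (n + 2) = (real n + 2) * fact (n + 1)"
        by (simp add: algebra_simps)
      have "(real n + 2) * geg_coeff \<mu> 0 (n + 2) = 2 * (real n + 1 + \<mu>) * geg_coeff \<mu> 0 (n + 1)"
        unfolding geg_coeff_def add_0_right P F by (simp add: divide_simps del: fact_Suc)
      thus ?thesis
        using 1 2 3 m by simp
    next
      case (Suc i)
      have n: "n = m + 2 * i" using j Suc by simp
      have 1: "coeff (gegenbauer \<mu> (n + 2)) m = geg_coeff \<mu> (Suc i) m"
        using coeff_gegenbauer_add[of \<mu> m "Suc i"] n by simp
      have 2: "coeff (gegenbauer \<mu> n) m = geg_coeff \<mu> i m"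
        using coeff_gegenbauer_add[of \<mu> m i] n by simp
      show ?thesis
      proof (cases m)
        case 0
        have "(2 * real i + 2) * geg_coeff \<mu> (Suc i) 0 = - ((2 * real i + 2 * \<mu>) * geg_coeff \<mu> i 0)"
          by (simp add: geg_coeff_def pochhammer_Suc divide_simps) (simp add: algebra_simps)
        thus ?thesis using 1 2 n 0 by simp
      next
        case m: (Suc l)
        have "n + 1 = l + 2 * Suc i" using n m by simp
        hence 3: "coeff (gegenbauer \<mu> (n + 1)) l = geg_coeff \<mu> (Suc i) l"
          using coeff_gegenbauer_add[of \<mu> l "Suc i"] by metis
        \<comment> \<open>A common factor of the three coefficients involved; dividing it out leaves
          a rational identity in \<open>l\<close>, \<open>i\<close> and
          \<open>\<mu>\<close>.\<close>
        define u where "u = (- 1) ^ i * pochhammer \<mu> (l + i + 1) * 2 ^ l / (fact i * fact l)"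
        have u: "geg_coeff \<mu> (Suc i) m =
            - (2 * u * (\<mu> + real l + real i + 1) / ((real i + 1) * (real l + 1)))"
          "geg_coeff \<mu> (Suc i) l = - (u / (real i + 1))"
          "geg_coeff \<mu> i m = 2 * u / (real l + 1)"
          unfolding m geg_coeff_def u_def
          by (simp_all add: pochhammer_Suc divide_simps) (simp_all add: algebra_simps)
        have n': "real n = real l + 2 * real i + 1" using n m by simp
        have "(real n + 2) * geg_coeff \<mu> (Suc i) m =
            2 * (real n + 1 + \<mu>) * geg_coeff \<mu> (Suc i) l - (real n + 2 * \<mu>) * geg_coeff \<mu> i m"
          unfolding u n' by (simp add: divide_simps) (simp add: algebra_simps)
        moreover have "coeff ([:0, 1:] * gegenbauer \<mu> (n + 1)) m = geg_coeff \<mu> (Suc i) l"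
          using 3 m by simp
        ultimately show ?thesis
          unfolding coeff_diff coeff_smult 1 2 by simp
      qed
    qed
  qed
qed

text \<open>The classical equation (1 - x^2) y'' - (2 \<mu> + 1) x y' + n (n + 2 \<mu>) y = 0. At
  x^m it only links the coefficients of index m and m + 2, whose ratio is explicit.\<close>

lemma gegenbauer_ode:
  "[:1, 0, -1:] * pderiv (pderiv (gegenbauer \<mu> n))
     - smult (2 * \<mu> + 1) ([:0, 1:] * pderiv (gegenbauer \<mu> n))
   = smult (- (real n * (real n + 2 * \<mu>))) (gegenbauer \<mu> n)" (is "?l = ?r")
proof (rule poly_eqI)
  fix m
  let ?C = "gegenbauer \<mu> n"
  have X: "[:1, 0, -1:] * p = p - pCons 0 (pCons 0 p)" for p :: "real poly"
    by simp
  have 1: "coeff ?l m = (real m + 2) * (real m + 1) * coeff ?C (m + 2)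
      - real m * (real m + 2 * \<mu>) * coeff ?C m"
    unfolding X by (cases m; cases "m - 1") (auto simp: coeff_pCons coeff_pderiv algebra_simps)
  show "coeff ?l m = coeff ?r m"
  proof (cases "\<exists>j. n = m + 2 * j")
    case False
    hence "coeff ?C m = 0"
      by (intro coeff_gegenbauer_eq_0) auto
    moreover have "coeff ?C (m + 2) = 0"
    proof (rule coeff_gegenbauer_eq_0)
      show "n \<noteq> m + 2 + 2 * j" for j
        using False by (metis add.assoc mult_Suc_right)
    qed
    ultimately show ?thesis using 1 by simp
  next
    case True
    then obtain j where n: "n = m + 2 * j" by blast
    have 2: "coeff ?C m = geg_coeff \<mu> j m"
      using coeff_gegenbauer_add[of \<mu> m j] n by simp
    \<comment> \<open>For n = m + 2j one has n (n + 2 \<mu>) - m (m + 2 \<mu>) = 4j (m + j + \<mu>),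
      so this is exactly what the equation demands at x^m.\<close>
    have "(real m + 2) * (real m + 1) * coeff ?C (m + 2)
        = - (4 * real j * (real m + real j + \<mu>)) * geg_coeff \<mu> j m"
    proof (cases j)
      case 0
      thus ?thesis using n by (simp add: coeff_gegenbauer_eq_0)
    next
      case (Suc i)
      have "coeff ?C (m + 2) = geg_coeff \<mu> i (m + 2)"
        using coeff_gegenbauer_add[of \<mu> "m + 2" i] n Suc by (simp add: algebra_simps)
      also have "\<dots> = - (4 * real j * (real m + real j + \<mu>)) * geg_coeff \<mu> j m
          / ((real m + 2) * (real m + 1))"
      proof -
        have P: "pochhammer \<mu> (m + 2 + i) = pochhammer \<mu> (m + j) * (real m + real j + \<mu>)"
          using Suc pochhammer_Suc[of \<mu> "m + j"] by (simp add: algebra_simps)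
        have F: "fact (m + 2) = (real m + 2) * (real m + 1) * fact m"
          by (simp add: algebra_simps)
        have J: "fact j = real j * fact i" "(- 1) ^ j = - ((- 1) ^ i :: real)" "real j \<noteq> 0"
          using Suc by auto
        show ?thesis
          unfolding geg_coeff_def P F J power_add using J(3) by (simp add: divide_simps)
      qed
      finally show ?thesis by simp
    qed
    thus ?thesis unfolding 1 using 2 n by (simp add: algebra_simps)
  qed
qed

section \<open>Rewriting of the constants \<open>h_norm\<close>\<close>

text \<open>Raising i by one removes the last two factors from both
  \<open>pochhammer (2 * \<mu>) (k - 2 * i)\<close> and \<open>fact (k - 2 * i)\<close>. Up to a
  factor 1/4 each, these products are the factors gained by the four Pochhammer symbols; the signs
  cancel in pairs.\<close>

lemma h_norm_quotient:
  fixes \<mu> :: real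
  assumes "\<mu> > - 1/2" "\<mu> \<noteq> 0" "2 * i \<le> k"
  shows "h_norm \<mu> (k - 2 * i) =
    pochhammer (2 * \<mu>) k * \<mu> / (fact k * (real (k - 2 * i) + \<mu>))
    * (pochhammer (- real k / 2) i * pochhammer ((- real k + 1) / 2) i
       / (pochhammer ((- real k + 1) / 2 - \<mu>) i * pochhammer ((- real k + 2) / 2 - \<mu>) i))"
proof -
  let ?N = "\<lambda>i. pochhammer (- real k / 2) i * pochhammer ((- real k + 1) / 2) i"
  let ?D = "\<lambda>i. pochhammer ((- real k + 1) / 2 - \<mu>) i * pochhammer ((- real k + 2) / 2 - \<mu>) i"
  \<comment> \<open>The induction carries a division-free form together with the nonvanishing of the
    denominator.\<close>
  have *: "?D i \<noteq> 0 \<and> pochhammer (2 * \<mu>) (k - 2 * i) * fact k * ?D i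
      = pochhammer (2 * \<mu>) k * fact (k - 2 * i) * ?N i"
    using assms(3)
  proof (induction i)
    case (Suc i)
    define l where "l = k - 2 * Suc i"
    have k: "k = l + 2 * i + 2" and kl: "k - 2 * i = Suc (Suc l)" "k - 2 * Suc i = l"
      using Suc.prems by (auto simp: l_def)
    have k': "real k = real l + 2 * real i + 2" using k by simp
    define a where "a = ?D i"
    define b where "b = ?N i"
    \<comment> \<open>Both follow from 2 \<mu> > -1, except the first one at l = 0, which is \<mu>
      \<noteq> 0.\<close>
    have nz: "2 * \<mu> + real l \<noteq> 0" "2 * \<mu> + real l + 1 \<noteq> 0"
      using assms(1,2) by (cases l; auto)+
    have D: "4 * ?D (Suc i) = a * ((2 * \<mu> + real l) * (2 * \<mu> + real l + 1))"
      unfolding a_def pochhammer_Suc k' by (simp add: field_simps)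
    have N: "4 * ?N (Suc i) = b * ((real l + 1) * (real l + 2))"
      unfolding b_def pochhammer_Suc k' by (simp add: field_simps)
    have IH: "a \<noteq> 0" "pochhammer (2 * \<mu>) l * (2 * \<mu> + real l) * (2 * \<mu> + real l + 1) * fact k * a
        = pochhammer (2 * \<mu>) k * ((real l + 2) * (real l + 1) * fact l) * b"
      using Suc.IH Suc.prems unfolding a_def[symmetric] b_def[symmetric] kl
      by (auto simp: pochhammer_Suc algebra_simps)
    have "pochhammer (2 * \<mu>) l * fact k * (4 * ?D (Suc i))
        = pochhammer (2 * \<mu>) k * fact l * (4 * ?N (Suc i))"
      unfolding D N using IH(2) by (simp only: mult_ac)
    moreover have "4 * ?D (Suc i) \<noteq> 0"
      unfolding D using nz IH(1) by simp
    ultimately show ?case unfolding kl by simp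
  qed simp
  have nz: "real (k - 2 * i) + \<mu> \<noteq> 0"
    using assms(1,2) by (cases "k - 2 * i") auto
  have "h_norm \<mu> (k - 2 * i) = \<mu> / (real (k - 2 * i) + \<mu>)
      * (pochhammer (2 * \<mu>) (k - 2 * i) / fact (k - 2 * i))"
    by (simp add: h_norm_def)
  also have "pochhammer (2 * \<mu>) (k - 2 * i) / fact (k - 2 * i)
      = pochhammer (2 * \<mu>) k / fact k * (?N i / ?D i)"
    using * by (simp add: divide_simps) (simp add: mult_ac)
  finally show ?thesis by (simp add: mult_ac)
qed

section \<open>The substitution x = t y in the plane\<close>

text \<open>Fubini with x integrated first: for t \<noteq> 0 the substitution x = t y has Jacobian
  |t|, which cancels the denominator, and t = 0 is a null set. The same computation with absolute
  values gives integrability on the plane.\<close>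

lemma has_bochner_integral_product_quotient:
  fixes f g :: "real \<Rightarrow> real"
  assumes f: "integrable lborel f" and g: "integrable lborel g"
  shows "has_bochner_integral lborel (\<lambda>(x, t). f t * g (x / t) / \<bar>t\<bar>)
           (integral\<^sup>L lborel f * integral\<^sup>L lborel g)"
proof -
  have mf[measurable]: "f \<in> borel_measurable borel" and mg[measurable]: "g \<in> borel_measurable borel"
    using f g by (auto dest: borel_measurable_integrable)
  \<comment> \<open>The pair is ordered (t, x), so that x is the inner variable; \<open>swap\<close>
    restores the order used by the cone.\<close>
  let ?F = "\<lambda>(t, x). f t * g (x / t) / \<bar>t\<bar>"
  have scale: "integrable lborel (\<lambda>x. h (x / t))"
    "(\<integral>x. h (x / t) \<partial>lborel) = \<bar>t\<bar> * integral\<^sup>L lborel h"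
    if "t \<noteq> 0" "integrable lborel h" for t and h :: "real \<Rightarrow> real"
    using that lborel_integrable_real_affine[of h "1/t" 0]
      lborel_integral_real_affine[of "1/t" h 0] by (auto simp: field_simps)
  have ae: "AE t in lborel. t \<noteq> (0::real)"
    by (rule AE_lborel_singleton)
  have inner: "AE t in lborel. (\<integral>x. ?F (t, x) \<partial>lborel) = f t * integral\<^sup>L lborel g"
    using ae by eventually_elim (simp add: scale g)
  have inner': "AE t in lborel. (\<integral>x. norm (?F (t, x)) \<partial>lborel) = \<bar>f t\<bar> * (\<integral>y. \<bar>g y\<bar> \<partial>lborel)"
    using ae
  proof eventually_elim
    case (elim t)
    have "integrable lborel (\<lambda>y. \<bar>g y\<bar>)" using g by simp
    from scale(2)[OF elim this] show ?case using elim by (simp add: abs_mult)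
  qed
  have int: "integrable (lborel \<Otimes>\<^sub>M lborel) ?F"
  proof (rule lborel_pair.Fubini_integrable)
    show "?F \<in> borel_measurable (lborel \<Otimes>\<^sub>M lborel)" by measurable
    show "AE t in lborel. integrable lborel (\<lambda>x. ?F (t, x))"
      using ae by eventually_elim (simp add: scale g)
    have "integrable lborel (\<lambda>t. \<bar>f t\<bar> * (\<integral>y. \<bar>g y\<bar> \<partial>lborel))" using f by simp
    thus "integrable lborel (\<lambda>t. \<integral>x. norm (?F (t, x)) \<partial>lborel)"
      by (subst integrable_cong_AE[OF _ _ inner']) measurable
  qed
  have "integral\<^sup>L (lborel \<Otimes>\<^sub>M lborel) ?F = (\<integral>t. (\<integral>x. ?F (t, x) \<partial>lborel) \<partial>lborel)"
    by (rule lborel_pair.integral_fst'[OF int, symmetric])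
  also have "\<dots> = (\<integral>t. f t * integral\<^sup>L lborel g \<partial>lborel)"
    by (rule integral_cong_AE[OF _ _ inner]) measurable
  finally have val: "integral\<^sup>L (lborel \<Otimes>\<^sub>M lborel) ?F = integral\<^sup>L lborel f * integral\<^sup>L lborel g"
    by simp
  have swap: "(\<lambda>(x, t). ?F (t, x)) = (\<lambda>(x, t). f t * g (x / t) / \<bar>t\<bar>)" by auto
  show ?thesis
    unfolding has_bochner_integral_iff lborel_prod[symmetric] swap[symmetric]
    using lborel_pair.integrable_product_swap[OF int]
      lborel_pair.integral_product_swap[OF borel_measurable_integrable[OF int]] val
    by simp
qed

section \<open>Integration of polynomials against the Gegenbauer weight\<close>

definition geg_weight :: "real \<Rightarrow> real \<Rightarrow> real" where
  "geg_weight \<mu> y = (1 - y\<^sup>2) powr (\<mu> - 1/2)"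

text \<open>A functional on polynomials instead of functions: for \<mu> > -1/2 every argument is
  integrable, so linearity has no side conditions. It is left unnormalized, since its total mass
  \<open>geg_int \<mu> 1\<close> cancels in the end.\<close>

definition geg_int :: "real \<Rightarrow> real poly \<Rightarrow> real" where
  "geg_int \<mu> p = (LINT y:{-1..1}|lborel. poly p y * geg_weight \<mu> y)"

text \<open>With y = 2t - 1 one has 1 - y^2 = 4 t (1 - t), which turns the weight into a Beta
  integrand with both exponents \<mu> - 1/2 > -1.\<close>

lemma set_integrable_geg_weight:
  assumes "\<mu> > - 1/2"
  shows "set_integrable lborel {-1..1} (geg_weight \<mu>)"
proof -
  have "set_integrable lborel {0..1} (\<lambda>t. t powr (\<mu> + 1/2 - 1) * (1 - t) powr (\<mu> + 1/2 - 1) :: real)"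
    using assms by (intro integrable_Beta) auto
  hence "integrable lborel (\<lambda>t. indicator {0..1} t * (t powr (\<mu> - 1/2) * (1 - t) powr (\<mu> - 1/2)))"
    by (simp add: set_integrable_def)
  from lborel_integrable_real_affine[OF this, of "1/2" "1/2"]
  have 1: "integrable lborel (\<lambda>y. 4 powr (\<mu> - 1/2) * (indicator {0..1} (1/2 + 1/2 * y)
      * ((1/2 + 1/2 * y) powr (\<mu> - 1/2) * (1 - (1/2 + 1/2 * y)) powr (\<mu> - 1/2))))"
    by simp
  have "4 powr (\<mu> - 1/2) * (indicator {0..1} (1/2 + 1/2 * y)
      * ((1/2 + 1/2 * y) powr (\<mu> - 1/2) * (1 - (1/2 + 1/2 * y)) powr (\<mu> - 1/2)))
    = indicator {-1..1} y *\<^sub>R geg_weight \<mu> y" for y :: real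
  proof (cases "y \<in> {-1..1}")
    case True
    have "1 - y\<^sup>2 = 4 * ((1/2 + 1/2 * y) * (1 - (1/2 + 1/2 * y)))"
      by (simp add: power2_eq_square field_simps)
    hence "geg_weight \<mu> y = 4 powr (\<mu> - 1/2)
        * ((1/2 + 1/2 * y) powr (\<mu> - 1/2) * (1 - (1/2 + 1/2 * y)) powr (\<mu> - 1/2))"
      unfolding geg_weight_def by (simp only: powr_mult)
    thus ?thesis using True by (simp add: indicator_def)
  qed (auto simp: indicator_def)
  with 1 show ?thesis by (simp only: set_integrable_def)
qed

lemma set_integrable_poly_geg_weight:
  assumes "\<mu> > - 1/2"
  shows "set_integrable lborel {-1..1} (\<lambda>y. poly p y * geg_weight \<mu> y)"
proof -
  have "bounded (poly p ` {-1..1})"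
    by (intro compact_imp_bounded compact_continuous_image continuous_intros) auto
  then obtain B where "\<forall>y\<in>{-1..1}. \<bar>poly p y\<bar> \<le> B"
    by (auto simp: bounded_iff)
  hence B: "\<bar>poly p y\<bar> \<le> B" if "y \<in> {-1..1}" for y
    using that by blast
  have int: "integrable lborel (\<lambda>y. B * (indicator {-1..1} y *\<^sub>R geg_weight \<mu> y))"
    using set_integrable_geg_weight[OF assms] unfolding set_integrable_def
    by (rule integrable_mult_right)
  have [measurable]: "poly p \<in> borel_measurable borel"
    by (intro borel_measurable_continuous_onI continuous_intros)
  have [measurable]: "geg_weight \<mu> \<in> borel_measurable borel"
    unfolding geg_weight_def by measurable
  show ?thesis
    unfolding set_integrable_def
  proof (rule Bochner_Integration.integrable_bound[OF int])
    show "AE y in lborel. norm (indicator {-1..1} y *\<^sub>R (poly p y * geg_weight \<mu> y))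
        \<le> norm (B * (indicator {-1..1} y *\<^sub>R geg_weight \<mu> y))"
    proof (rule AE_I2)
      fix y :: real
      have "\<bar>poly p y\<bar> * geg_weight \<mu> y \<le> \<bar>B\<bar> * geg_weight \<mu> y" if "y \<in> {-1..1}"
        using B[OF that] by (intro mult_right_mono) (auto simp: geg_weight_def)
      thus "norm (indicator {-1..1} y *\<^sub>R (poly p y * geg_weight \<mu> y))
          \<le> norm (B * (indicator {-1..1} y *\<^sub>R geg_weight \<mu> y))"
        by (auto simp: indicator_def abs_mult geg_weight_def)
    qed
  qed measurable
qed

context
  fixes \<mu> :: real
  assumes mu: "\<mu> > - 1/2"
begin

lemma geg_int_add: "geg_int \<mu> (p + q) = geg_int \<mu> p + geg_int \<mu> q"
  unfolding geg_int_def using set_integrable_poly_geg_weight[OF mu]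
  by (simp add: distrib_right set_integral_add)

lemma geg_int_smult: "geg_int \<mu> (smult c p) = c * geg_int \<mu> p"
  unfolding geg_int_def by (simp add: mult.assoc)

lemma geg_int_minus: "geg_int \<mu> (p - q) = geg_int \<mu> p - geg_int \<mu> q"
  unfolding geg_int_def using set_integrable_poly_geg_weight[OF mu]
  by (simp add: left_diff_distrib set_integral_diff)

text \<open>The weight is positive on the open interval, which is not a null set. This permits
  cancelling the total mass against the one contained in \<open>b_cone\<close>.\<close>

lemma geg_int_one_pos: "geg_int \<mu> 1 > 0"
proof -
  have int: "integrable lborel (\<lambda>y. indicator {-1..1} y *\<^sub>R geg_weight \<mu> y)"
    using set_integrable_geg_weight[OF mu] by (simp add: set_integrable_def)
  have nn: "AE y in lborel. 0 \<le> indicator {-1..1} y *\<^sub>R geg_weight \<mu> y"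
    by (auto simp: geg_weight_def indicator_def)
  have "integral\<^sup>L lborel (\<lambda>y. indicator {-1..1} y *\<^sub>R geg_weight \<mu> y) \<noteq> 0"
  proof
    assume "integral\<^sup>L lborel (\<lambda>y. indicator {-1..1} y *\<^sub>R geg_weight \<mu> y) = 0"
    hence "AE y in lborel. indicator {-1..1} y *\<^sub>R geg_weight \<mu> y = 0"
      using integral_nonneg_eq_0_iff_AE[OF int nn] by simp
    hence "AE y in lborel. y \<notin> {-1<..<1::real}"
    proof eventually_elim
      case (elim y)
      show ?case
      proof
        assume y: "y \<in> {-1<..<1}"
        hence "y\<^sup>2 < 1" by (simp add: abs_square_less_1 abs_less_iff)
        with elim y show False by (auto simp: geg_weight_def)
      qed
    qed
    hence "emeasure lborel {-1<..<1::real} = 0"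
      by (subst (asm) AE_iff_measurable[of "{-1<..<1}"]) auto
    thus False by simp
  qed
  moreover have "integral\<^sup>L lborel (\<lambda>y. indicator {-1..1} y *\<^sub>R geg_weight \<mu> y) \<ge> 0"
    using nn by (rule integral_nonneg_AE)
  ultimately show ?thesis by (simp add: geg_int_def set_lebesgue_integral_def)
qed

text \<open>The integrand is the derivative of p(y) (1 - y^2)^(\<mu> + 1/2), and this function
  vanishes at both ends because \<mu> + 1/2 > 0.\<close>

lemma geg_int_by_parts:
  "geg_int \<mu> ([:1, 0, -1:] * pderiv p - smult (2 * \<mu> + 1) ([:0, 1:] * p)) = 0"
proof -
  let ?q = "[:1, 0, -1:] * pderiv p - smult (2 * \<mu> + 1) ([:0, 1:] * p)"
  let ?f = "\<lambda>y. poly p y * (1 - y\<^sup>2) powr (\<mu> + 1/2)"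
  have "((\<lambda>y. poly ?q y * geg_weight \<mu> y) has_integral (?f 1 - ?f (-1))) {-1..1}"
  \<comment> \<open>The weight may be unbounded at the ends, so differentiability is asked only
    inside and continuity on the closed interval.\<close>
  proof (rule fundamental_theorem_of_calculus_interior)
    have "continuous_on {-1..1} (\<lambda>y::real. (1 - y\<^sup>2) powr (\<mu> + 1/2))"
      using mu by (intro continuous_on_powr' continuous_intros)
        (auto simp: abs_square_le_1 abs_le_iff)
    thus "continuous_on {-1..1} ?f"
      by (intro continuous_on_mult continuous_on_poly continuous_on_id)
    fix y :: real assume y: "y \<in> {-1<..<1}"
    hence pos: "1 - y\<^sup>2 > 0" by (simp add: abs_square_less_1 abs_less_iff)
    have *: "(1 - y\<^sup>2) powr (\<mu> + 1/2) = (1 - y\<^sup>2) * geg_weight \<mu> y"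
      using pos powr_add[of "1 - y\<^sup>2" 1 "\<mu> - 1/2"] by (simp add: geg_weight_def add.commute)
    have "(?f has_real_derivative (poly (pderiv p) y * (1 - y\<^sup>2) powr (\<mu> + 1/2)
        + poly p y * ((\<mu> + 1/2) * (1 - y\<^sup>2) powr (\<mu> + 1/2 - 1) * (- 2 * y)))) (at y)"
      using pos by (auto intro!: derivative_eq_intros simp: power2_eq_square)
    also have "poly (pderiv p) y * (1 - y\<^sup>2) powr (\<mu> + 1/2)
        + poly p y * ((\<mu> + 1/2) * (1 - y\<^sup>2) powr (\<mu> + 1/2 - 1) * (- 2 * y))
      = poly ?q y * geg_weight \<mu> y"
      unfolding * by (simp add: geg_weight_def power2_eq_square algebra_simps)
    finally show "(?f has_vector_derivative poly ?q y * geg_weight \<mu> y) (at y)"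
      by (simp add: has_real_derivative_iff_has_vector_derivative)
  qed simp
  hence "integral {-1..1} (\<lambda>y. poly ?q y * geg_weight \<mu> y) = 0"
    by (simp add: integral_unique)
  thus ?thesis
    unfolding geg_int_def
    using set_borel_integral_eq_integral(2)[OF set_integrable_poly_geg_weight[OF mu, of ?q]] by simp
qed

end

section \<open>Separation of variables on the cone\<close>

lemma weight_fun_poly_integrable:
  assumes "weight_fun w \<mu>"
  shows "integrable lborel (\<lambda>t. indicator {0..} t * (poly p t * (t powr (2 * \<mu>) * w t)))"
proof -
  have "integrable lborel (\<lambda>t. indicator {0..} t * (t ^ j * (t powr (2 * \<mu>) * w t)))" for j :: nat
  proof -
    have "set_integrable lborel {0..} (\<lambda>t. t powr (2 * \<mu> + real j) * w t)"
      using assms by (auto simp: weight_fun_def)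
    moreover have "(\<lambda>t. indicator {0..} t *\<^sub>R (t powr (2 * \<mu> + real j) * w t))
        = (\<lambda>t. indicator {0..} t * (t ^ j * (t powr (2 * \<mu>) * w t)))"
    proof
      show "indicator {0..} t *\<^sub>R (t powr (2 * \<mu> + real j) * w t)
          = indicator {0..} t * (t ^ j * (t powr (2 * \<mu>) * w t))" for t :: real
        \<comment> \<open>At t = 0 both sides vanish because \<open>0 powr a = 0\<close>, even for j
          = 0.\<close>
        by (cases "t = 0") (auto simp: indicator_def powr_add powr_realpow)
    qed
    ultimately show ?thesis by (simp only: set_integrable_def)
  qed
  hence "integrable lborel (\<lambda>t. \<Sum>j\<le>degree p.
      coeff p j * (indicator {0..} t * (t ^ j * (t powr (2 * \<mu>) * w t))))"
    by (intro Bochner_Integration.integrable_sum integrable_mult_right)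
  thus ?thesis
    by (simp add: poly_altdef sum_distrib_left sum_distrib_right mult_ac)
qed

text \<open>For t > 0 and y = x / t the factor (t^2 - x^2)^(\<mu> - 1/2) splits as t^(2 \<mu> - 1)
  (1 - y^2)^(\<mu> - 1/2). Writing t^(2 \<mu> - 1) as t^(2 \<mu>) / t supplies the denominator that
  the Jacobian cancels.\<close>

lemma has_bochner_integral_cone:
  assumes "\<mu> > - 1/2" "weight_fun w \<mu>"
  shows "has_bochner_integral lborel
     (\<lambda>(x, t). indicator cone_V2 (x, t) * (poly p t * poly r (x / t) * weight_W w \<mu> x t))
     ((LINT t:{0..}|lborel. poly p t * (t powr (2 * \<mu>) * w t)) * geg_int \<mu> r)"
proof -
  let ?f = "\<lambda>t. indicator {0..} t * (poly p t * (t powr (2 * \<mu>) * w t))"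
  let ?g = "\<lambda>y. indicator {-1..1} y * (poly r y * geg_weight \<mu> y)"
  have g: "integrable lborel ?g"
    using set_integrable_poly_geg_weight[OF assms(1), of r] by (simp add: set_integrable_def)
  have "?f t * ?g (x / t) / \<bar>t\<bar>
      = indicator cone_V2 (x, t) * (poly p t * poly r (x / t) * weight_W w \<mu> x t)" for x t
  proof (cases "t > 0")
    case True
    have "t\<^sup>2 - x\<^sup>2 = t\<^sup>2 * (1 - (x / t)\<^sup>2)"
      using True by (simp add: field_simps)
    hence "(t\<^sup>2 - x\<^sup>2) powr (\<mu> - 1/2) = (t\<^sup>2) powr (\<mu> - 1/2) * geg_weight \<mu> (x / t)"
      unfolding geg_weight_def by (simp only: powr_mult)
    moreover have "(t\<^sup>2) powr (\<mu> - 1/2) = t powr (2 * \<mu>) / t"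
    proof -
      have "(t\<^sup>2) powr (\<mu> - 1/2) = t powr (2 * \<mu> - 1)"
        using True powr_powr[of t 2 "\<mu> - 1/2"] by (simp add: algebra_simps)
      thus ?thesis using True by (simp add: powr_diff)
    qed
    moreover have "x / t \<in> {-1..1} \<longleftrightarrow> (x, t) \<in> cone_V2"
      using True by (auto simp: cone_V2_def field_simps)
    ultimately show ?thesis
      using True by (simp add: indicator_def weight_W_def)
  \<comment> \<open>For t < 0 both indicators vanish. At t = 0 only the origin lies in the cone, and
    there \<open>0 powr a = 0\<close> makes both sides zero.\<close>
  next
    case False
    thus ?thesis
      by (auto simp: indicator_def cone_V2_def weight_W_def)
  qed
  with has_bochner_integral_product_quotient[OF weight_fun_poly_integrable[OF assms(2), of p] g]
  show ?thesis by (simp add: geg_int_def set_lebesgue_integral_def)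
qed

section \<open>Orthogonality and norms of the Gegenbauer polynomials\<close>

context
  fixes \<mu> :: real
  assumes mu: "\<mu> > - 1/2"
begin

text \<open>Integration by parts applied to q p'. The right-hand side is symmetric in p and q, hence
  so is the bilinear form of the Gegenbauer operator.\<close>

lemma geg_int_symmetric:
  "geg_int \<mu> (q * ([:1, 0, -1:] * pderiv (pderiv p) - smult (2 * \<mu> + 1) ([:0, 1:] * pderiv p)))
     = - geg_int \<mu> ([:1, 0, -1:] * pderiv p * pderiv q)" (is "geg_int \<mu> ?l = _")
proof -
  have "[:1, 0, -1:] * pderiv (q * pderiv p) - smult (2 * \<mu> + 1) ([:0, 1:] * (q * pderiv p))
      = ?l + [:1, 0, -1:] * pderiv p * pderiv q"
    unfolding pderiv_mult right_diff_distrib distrib_left mult_smult_right by (simp only: ac_simps)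
  with geg_int_by_parts[OF mu, of "q * pderiv p"] show ?thesis
    by (simp add: geg_int_add[OF mu] eq_neg_iff_add_eq_0 del: mult_pCons_left mult_pCons_right)
qed

text \<open>By \<open>gegenbauer_ode\<close> the two factors are eigenvectors of a symmetric
  operator. Their eigenvalues differ by (n - m) (n + m + 2 \<mu>), up to sign, which is nonzero
  since n + m \<ge> 1 and 2 \<mu> > -1.\<close>

lemma gegenbauer_orthogonal:
  assumes "m \<noteq> n"
  shows "geg_int \<mu> (gegenbauer \<mu> m * gegenbauer \<mu> n) = 0"
proof -
  let ?I = "geg_int \<mu> (gegenbauer \<mu> m * gegenbauer \<mu> n)"
  let ?G = "geg_int \<mu> ([:1, 0, -1:] * pderiv (gegenbauer \<mu> n) * pderiv (gegenbauer \<mu> m))"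
  have "- (real n * (real n + 2 * \<mu>)) * ?I = - ?G"
    using geg_int_symmetric[of "gegenbauer \<mu> m" "gegenbauer \<mu> n"]
    unfolding gegenbauer_ode mult_smult_right geg_int_smult[OF mu] .
  moreover have "- (real m * (real m + 2 * \<mu>)) * ?I = - ?G"
    using geg_int_symmetric[of "gegenbauer \<mu> n" "gegenbauer \<mu> m"]
    unfolding gegenbauer_ode mult_smult_right geg_int_smult[OF mu]
    by (simp only: mult_ac)
  ultimately have "real n * (real n + 2 * \<mu>) * ?I = real m * (real m + 2 * \<mu>) * ?I"
    by (simp only: mult_minus_left neg_equal_iff_equal)
  hence "(real n - real m) * (real n + real m + 2 * \<mu>) * ?I = 0"
    by (simp add: algebra_simps)
  moreover have "real n + real m \<ge> 1"
    using assms by linarith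
  ultimately show ?thesis
    using assms mu by auto
qed

text \<open>Both norms are compared with the mixed integral \<open>?X\<close> of y C_(n+1) C_n. The
  recurrence for C_(n+1) is paired with C_(n+1), the one for C_(n+2) with C_n, and orthogonality
  kills the outer terms.\<close>

lemma gegenbauer_normsq_Suc:
  "(real n + 1) * (real n + 1 + \<mu>) * geg_int \<mu> (gegenbauer \<mu> (Suc n) * gegenbauer \<mu> (Suc n))
     = (real n + \<mu>) * (real n + 2 * \<mu>) * geg_int \<mu> (gegenbauer \<mu> n * gegenbauer \<mu> n)"
proof -
  let ?C = "gegenbauer \<mu>"
  let ?X = "geg_int \<mu> ([:0, 1:] * ?C (Suc n) * ?C n)"
  have 1: "(real n + 1) * geg_int \<mu> (?C (Suc n) * ?C (Suc n)) = 2 * (real n + \<mu>) * ?X"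
  proof (cases n)
    \<comment> \<open>The recurrence starts at degree 2, so C_1 = 2 \<mu> y is inserted
      directly.\<close>
    case 0
    have "?C 0 = 1" "?C 1 = smult (2 * \<mu>) [:0, 1:]"
      by (simp_all add: gegenbauer_def monom_altdef)
    hence "?C (Suc n) * ?C (Suc n) = smult (2 * \<mu>) ([:0, 1:] * ?C (Suc n) * ?C n)"
      using 0 by simp
    thus ?thesis using 0 by (simp only: geg_int_smult[OF mu]) simp
  next
    case (Suc l)
    have "smult (real l + 2) (?C (l + 2)) * ?C (l + 2) =
        smult (2 * (real l + 1 + \<mu>)) ([:0, 1:] * ?C (l + 2) * ?C (l + 1))
        - smult (real l + 2 * \<mu>) (?C l * ?C (l + 2))"
      unfolding gegenbauer_recurrence left_diff_distrib mult_smult_left by (simp only: mult_ac)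
    hence "geg_int \<mu> (smult (real l + 2) (?C (l + 2) * ?C (l + 2))) =
        geg_int \<mu> (smult (2 * (real l + 1 + \<mu>)) ([:0, 1:] * ?C (l + 2) * ?C (l + 1))
        - smult (real l + 2 * \<mu>) (?C l * ?C (l + 2)))"
      by (simp only: mult_smult_left)
    thus ?thesis
      unfolding geg_int_minus[OF mu] geg_int_smult[OF mu]
      using gegenbauer_orthogonal[of l "l + 2"] Suc by (simp add: algebra_simps)
  qed
  have "smult (real n + 2) (?C (n + 2)) * ?C n =
      smult (2 * (real n + 1 + \<mu>)) ([:0, 1:] * ?C (Suc n) * ?C n)
      - smult (real n + 2 * \<mu>) (?C n * ?C n)"
    unfolding gegenbauer_recurrence left_diff_distrib mult_smult_left by (simp only: mult_ac Suc_eq_plus1)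
  hence "geg_int \<mu> (smult (real n + 2) (?C (n + 2) * ?C n)) =
      geg_int \<mu> (smult (2 * (real n + 1 + \<mu>)) ([:0, 1:] * ?C (Suc n) * ?C n)
      - smult (real n + 2 * \<mu>) (?C n * ?C n))"
    by (simp only: mult_smult_left)
  hence 2: "2 * (real n + 1 + \<mu>) * ?X = (real n + 2 * \<mu>) * geg_int \<mu> (?C n * ?C n)"
    unfolding geg_int_minus[OF mu] geg_int_smult[OF mu]
    using gegenbauer_orthogonal[of "n + 2" n] by simp
  have "(real n + 1) * (real n + 1 + \<mu>) * geg_int \<mu> (?C (Suc n) * ?C (Suc n))
      = (real n + 1 + \<mu>) * ((real n + 1) * geg_int \<mu> (?C (Suc n) * ?C (Suc n)))"
    by (simp only: mult_ac)
  also have "\<dots> = (real n + \<mu>) * (2 * (real n + 1 + \<mu>) * ?X)"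
    unfolding 1 by (simp only: mult_ac)
  also have "\<dots> = (real n + \<mu>) * (real n + 2 * \<mu>) * geg_int \<mu> (?C n * ?C n)"
    unfolding 2 by (simp only: mult_ac)
  finally show ?thesis .
qed

text \<open>\<open>h_norm\<close> has the same ratio of consecutive terms and equals 1 at index 0,
  where \<mu> \<noteq> 0 enters.\<close>

lemma gegenbauer_normsq:
  assumes "\<mu> \<noteq> 0"
  shows "geg_int \<mu> (gegenbauer \<mu> n * gegenbauer \<mu> n) = h_norm \<mu> n * geg_int \<mu> 1"
proof (induction n)
  case 0
  show ?case using assms by (simp add: gegenbauer_def h_norm_def)
next
  case (Suc n)
  have nz: "real n + \<mu> \<noteq> 0" "real n + 1 + \<mu> \<noteq> 0"
    using mu assms by (cases n; auto)+
  have h: "(real n + 1) * (real n + 1 + \<mu>) * h_norm \<mu> (Suc n)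
      = (real n + \<mu>) * (real n + 2 * \<mu>) * h_norm \<mu> n"
    using nz by (simp add: h_norm_def pochhammer_Suc divide_simps) (simp add: algebra_simps)
  have "(real n + 1) * (real n + 1 + \<mu>) * geg_int \<mu> (gegenbauer \<mu> (Suc n) * gegenbauer \<mu> (Suc n))
      = (real n + 1) * (real n + 1 + \<mu>) * (h_norm \<mu> (Suc n) * geg_int \<mu> 1)"
    unfolding gegenbauer_normsq_Suc Suc.IH using h by (simp only: mult.assoc[symmetric])
  thus ?case using nz by simp
qed

end

section \<open>Expansion and integration of the square of \<open>V_poly\<close>\<close>

lemma powr_even_add:
  fixes t \<mu> :: real
  assumes "t \<ge> 0"
  shows "t powr (2 * real m + 2 * \<mu>) = t ^ m * t ^ m * t powr (2 * \<mu>)"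
proof (cases "t = 0")
  case False
  hence "t powr real (m + m) = t ^ (m + m)"
    using assms by (intro powr_realpow) simp
  thus ?thesis by (simp add: powr_add power_add)
qed simp

theorem proposition3p2:
  fixes w :: "real \<Rightarrow> real" and \<mu> :: real and k n :: nat
  assumes "\<mu> > - 1/2" and "\<mu> \<noteq> 0"
    and "weight_fun w \<mu>"
    and "k \<le> n"
  shows "b_cone w \<mu> * set_lebesgue_integral lborel cone_V2
             (\<lambda>(x, t). \<bar>V_poly w \<mu> k n x t\<bar>\<^sup>2 * weight_W w \<mu> x t)
           = (\<Sum>i\<le>k div 2. (c_coeff \<mu> k i)\<^sup>2 * h_norm \<mu> (k - 2 * i)
                              * q_normsq w \<mu> (k - 2 * i) (n - k + 2 * i))
         \<and> (\<forall>i\<le>k div 2. h_norm \<mu> (k - 2 * i) =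
              pochhammer (2 * \<mu>) k * \<mu> / (fact k * (real (k - 2 * i) + \<mu>))
              * (pochhammer (- real k / 2) i * pochhammer ((- real k + 1) / 2) i
                 / (pochhammer ((- real k + 1) / 2 - \<mu>) i * pochhammer ((- real k + 2) / 2 - \<mu>) i)))"
proof (intro conjI allI impI)
  fix i assume "i \<le> k div 2"
  thus "h_norm \<mu> (k - 2 * i) =
              pochhammer (2 * \<mu>) k * \<mu> / (fact k * (real (k - 2 * i) + \<mu>))
              * (pochhammer (- real k / 2) i * pochhammer ((- real k + 1) / 2) i
                 / (pochhammer ((- real k + 1) / 2 - \<mu>) i * pochhammer ((- real k + 2) / 2 - \<mu>) i))"
    using assms by (intro h_norm_quotient) auto
next
  let ?m = "\<lambda>j. k - 2 * j"
  define J where "J p = (LINT t:{0..}|lborel. poly p t * (t powr (2 * \<mu>) * w t))" for p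
  define q where "q j = orth_q w (2 * real (?m j) + 2 * \<mu>) (n - ?m j)" for j
  \<comment> \<open>The power of t in \<open>S_basis\<close> is absorbed here, so each summand
    becomes Q(t) C(x / t) and a single weight t^(2 \<mu>) w(t) serves all of them.\<close>
  define Q where "Q j = q j * monom 1 (?m j)" for j
  define C where "C j = gegenbauer \<mu> (?m j)" for j
  define c where "c j = c_coeff \<mu> k j" for j
  note cone = has_bochner_integral_cone[OF assms(1,3), folded J_def]
  have pos: "geg_int \<mu> 1 \<noteq> 0"
    using geg_int_one_pos[OF assms(1)] by simp
  \<comment> \<open>The cone formula for the constant polynomials 1 and 1.\<close>
  have b: "b_cone w \<mu> = inverse (J 1 * geg_int \<mu> 1)"
    using has_bochner_integral_integral_eq[OF cone[of 1 1]]
    by (simp add: b_cone_def set_lebesgue_integral_def case_prod_unfold)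
  have bw: "b_w w \<mu> = inverse (J 1)"
    by (simp add: b_w_def J_def)
  have V: "(V_poly w \<mu> k n x t)\<^sup>2 =
      (\<Sum>i\<le>k div 2. \<Sum>j\<le>k div 2. c i * c j * (poly (Q i * Q j) t * poly (C i * C j) (x / t)))" for x t
  proof -
    have "V_poly w \<mu> k n x t = (\<Sum>j\<le>k div 2. c j * (poly (Q j) t * poly (C j) (x / t)))"
      unfolding V_poly_def S_basis_def c_def Q_def q_def C_def
      by (simp add: poly_monom mult.assoc)
    thus ?thesis
      by (simp add: power2_eq_square sum_product mult_ac)
  qed
  have int: "has_bochner_integral lborel
      (\<lambda>z. \<Sum>i\<le>k div 2. \<Sum>j\<le>k div 2. c i * c j * (case z of (x, t) \<Rightarrow> indicator cone_V2 (x, t) *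
        (poly (Q i * Q j) t * poly (C i * C j) (x / t) * weight_W w \<mu> x t)))
      (\<Sum>i\<le>k div 2. \<Sum>j\<le>k div 2. c i * c j * (J (Q i * Q j) * geg_int \<mu> (C i * C j)))"
    by (intro has_bochner_integral_sum has_bochner_integral_mult_right cone)
  have "set_lebesgue_integral lborel cone_V2
      (\<lambda>(x, t). \<bar>V_poly w \<mu> k n x t\<bar>\<^sup>2 * weight_W w \<mu> x t)
    = (\<Sum>i\<le>k div 2. \<Sum>j\<le>k div 2. c i * c j * (J (Q i * Q j) * geg_int \<mu> (C i * C j)))"
    unfolding set_lebesgue_integral_def has_bochner_integral_integral_eq[OF int, symmetric]
    by (intro Bochner_Integration.integral_cong refl)
      (auto simp: V sum_distrib_left sum_distrib_right mult_ac)
  also have "\<dots> = (\<Sum>i\<le>k div 2. \<Sum>j\<le>k div 2. if j = i then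
      (c i)\<^sup>2 * (J (Q i * Q i) * (h_norm \<mu> (?m i) * geg_int \<mu> 1)) else 0)"
  proof (intro sum.cong refl)
    fix i j assume "i \<in> {..k div 2}" "j \<in> {..k div 2}"
    \<comment> \<open>Since 2i and 2j are at most k, no subtraction is truncated and distinct
      indices give distinct degrees.\<close>
    hence "i \<noteq> j \<Longrightarrow> ?m i \<noteq> ?m j" by auto
    thus "c i * c j * (J (Q i * Q j) * geg_int \<mu> (C i * C j)) =
      (if j = i then (c i)\<^sup>2 * (J (Q i * Q i) * (h_norm \<mu> (?m i) * geg_int \<mu> 1)) else 0)"
      by (auto simp: C_def gegenbauer_normsq[OF assms(1,2)] gegenbauer_orthogonal[OF assms(1)]
          power2_eq_square)
  qed
  also have "\<dots> = (\<Sum>i\<le>k div 2. (c i)\<^sup>2 * (J (Q i * Q i) * (h_norm \<mu> (?m i) * geg_int \<mu> 1)))"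
    by (intro sum.cong refl) (simp add: sum.delta)
  finally have I: "set_lebesgue_integral lborel cone_V2
      (\<lambda>(x, t). \<bar>V_poly w \<mu> k n x t\<bar>\<^sup>2 * weight_W w \<mu> x t)
    = (\<Sum>i\<le>k div 2. (c i)\<^sup>2 * (J (Q i * Q i) * (h_norm \<mu> (?m i) * geg_int \<mu> 1)))" .
  \<comment> \<open>Here g is the total mass of the Gegenbauer weight. If \<open>J 1 = 0\<close>,
    both sides are zero by \<open>inverse 0 = 0\<close>.\<close>
  have cancel: "inverse (J 1 * g) * (a * (z * (h * g))) = a * h * (inverse (J 1) * z)"
    if "g \<noteq> 0" for g a z h :: real
    using that by (cases "J 1 = 0") (simp_all add: field_simps)
  have "b_cone w \<mu> * set_lebesgue_integral lborel cone_V2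
      (\<lambda>(x, t). \<bar>V_poly w \<mu> k n x t\<bar>\<^sup>2 * weight_W w \<mu> x t)
    = (\<Sum>i\<le>k div 2. (c i)\<^sup>2 * h_norm \<mu> (?m i) * (b_w w \<mu> * J (Q i * Q i)))"
    unfolding b bw I sum_distrib_left by (intro sum.cong refl cancel pos)
  also have "\<dots> = (\<Sum>i\<le>k div 2. (c_coeff \<mu> k i)\<^sup>2 * h_norm \<mu> (?m i)
      * q_normsq w \<mu> (?m i) (n - k + 2 * i))"
  proof (intro sum.cong refl)
    fix i assume "i \<in> {..k div 2}"
    \<comment> \<open>Uses k \<le> n and 2i \<le> k, so the natural subtractions agree.\<close>
    hence m: "n - k + 2 * i = n - ?m i" using assms(4) by auto
    \<comment> \<open>The powers of t inside the square of \<open>Q i\<close> raise t^(2 \<mu>) to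
      the weight that defines \<open>q i\<close>, whence \<open>q_normsq\<close>.\<close>
    have "J (Q i * Q i) = (LINT t:{0..}|lborel.
        \<bar>poly (q i) t\<bar>\<^sup>2 * t powr (2 * real (?m i) + 2 * \<mu>) * w t)"
      unfolding J_def
    proof (rule set_lebesgue_integral_cong)
      show "\<forall>t. t \<in> {0..} \<longrightarrow> poly (Q i * Q i) t * (t powr (2 * \<mu>) * w t)
          = \<bar>poly (q i) t\<bar>\<^sup>2 * t powr (2 * real (?m i) + 2 * \<mu>) * w t"
      proof (intro allI impI)
        fix t :: real assume "t \<in> {0..}"
        have "t powr (2 * real (?m i) + 2 * \<mu>) = t ^ (?m i) * t ^ (?m i) * t powr (2 * \<mu>)"
          using \<open>t \<in> {0..}\<close> by (intro powr_even_add) simp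
        thus "poly (Q i * Q i) t * (t powr (2 * \<mu>) * w t)
            = \<bar>poly (q i) t\<bar>\<^sup>2 * t powr (2 * real (?m i) + 2 * \<mu>) * w t"
          by (simp add: Q_def poly_monom power2_eq_square mult_ac)
      qed
    qed simp
    thus "(c i)\<^sup>2 * h_norm \<mu> (?m i) * (b_w w \<mu> * J (Q i * Q i)) =
        (c_coeff \<mu> k i)\<^sup>2 * h_norm \<mu> (?m i) * q_normsq w \<mu> (?m i) (n - k + 2 * i)"
      unfolding q_normsq_def m q_def c_def by simp
  qed
  finally show "b_cone w \<mu> * set_lebesgue_integral lborel cone_V2
             (\<lambda>(x, t). \<bar>V_poly w \<mu> k n x t\<bar>\<^sup>2 * weight_W w \<mu> x t)
           = (\<Sum>i\<le>k div 2. (c_coeff \<mu> k i)\<^sup>2 * h_norm \<mu> (k - 2 * i)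
                              * q_normsq w \<mu> (k - 2 * i) (n - k + 2 * i))" .
qed

end
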